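(* Let $f\in\mathbb{F}_2[x]$ be irreducible with $\deg(f)=m$. Suppose that $\boldsymbol g^*=(g_1^*,\ldots,g_s^* )\in G_m^s$ is constructed by the following component-by-component algorithm: $g_1^*=1$; and for $d=2,3,\ldots,s$, with $g_1^*,\ldots,g_{d-1}^*$ already chosen, $g_d^*\in G_m$ is a minimizer of $B_{\boldsymbol\gamma}((g_1^*,\ldots,g_{d-1}^*,g_d),f)$ as a function of $g_d$ over $G_m$. Then for all $d\in[s]$ we have $$B_{\boldsymbol\gamma}((g_1^*,\ldots,g_d^* ),f)\le\frac1{2^m}\sum_{\emptyset\ne\mathfrak u\subseteq[d]}\gamma_{\mathfrak u}\left(\frac m2\right)^{|\mathfrak u|}\prod_{i\in\mathfrak u}(b_i-a_i).$$
   Context: Let $s,m\in\mathbb{N}$, $[d]=\{1,\ldots,d\}$, let $-\infty<a_i<b_i<\infty$ for $i\in[s]$, and let $\boldsymbol\gamma=\{\gamma_{\mathfrak u}:\mathfrak u\subseteq[s]\}$ be positive real numbers (weights). $G_m=\{h\in\mathbb{F}_2[x]:\deg(h)<m\}$ (including $0$). Polynomial lattice point sets. For a formal Laurent series $g=\sum_{k=w}^\infty a_kx^{-k}\in\mathbb{F}_2((x^{-1}))$ let $\{g\}_m=\sum_{k=\max(1,w)}^ma_k2^{-k}\in[0,1)$ (and $\{0\}_m=0$). For $f\in\mathbb{F}_2[x]$ with $\deg f=m$ and $\boldsymbol g=(g_1,\ldots,g_d)\in\mathbb{F}_2[x]^d$, the polynomial lattice point set $\mathcal P(\boldsymbol g,f)$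 consists of the $2^m$ points (counted with multiplicity) $\boldsymbol x_h=(\{hg_1/f\}_m,\ldots,\{hg_d/f\}_m)$, $h\in\mathbb{F}_2[x]$, $\deg(h)<m$. Walsh functions. For $x\in[0,1)$ with dyadic expansion $x=\frac{\xi_1}2+\frac{\xi_2}{2^2}+\cdots$ (infinitely many digits different from $1$) and $k=\kappa_0+\kappa_12+\cdots+\kappa_{r-1}2^{r-1}\in\mathbb{N}_0$ with $\kappa_j\in\{0,1\}$, $\mathrm{wal}_k(x)=(-1)^{\kappa_0\xi_1+\cdots+\kappa_{r-1}\xi_r}$; $\mathrm{wal}_{\boldsymbol k_{\mathfrak u}}(\boldsymbol y_{\mathfrak u})=\prod_{i\in\mathfrak u}\mathrm{wal}_{k_i}(y_i)$ for $\boldsymbol k_{\mathfrak u}=(k_i)_{i\in\mathfrak u}$, $\boldsymbol y_{\mathfrak u}=(y_i)_{i\in\mathfrak u}$. The function $\mu$. $\mu(0)=0$, $\mu(k)=l$ if $2^{l-1}\le k<2^l$; $\mu(\boldsymbol k_{\mathfrak u})=\sum_{i\in\mathfrak u}\mu(k_i)$. Figure of merit. For points $\mathcal P=\{\boldsymbol y_0,\ldots,\boldsymbol y_{2^m-1}\}$ in $[0,1)^d$ and $\emptyset\ne\mathfrak u\subseteq[d]$, with $\boldsymbol y_{n,\mathfrak u}$ the projection of $\boldsymbol y_n$ to the components in $\mathfrak u$, put $E(\mathcal P,\mathfrak u)=\sum_{\boldsymbol k_{\mathfrak u}\in\{1,\ldots,2^m-1\}^{|\mathfrak u|}}2^{-\mu(\boldsymbol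 k_{\mathfrak u})}\left|\frac1{2^m}\sum_{n=0}^{2^m-1}\mathrm{wal}_{\boldsymbol k_{\mathfrak u}}(\boldsymbol y_{n,\mathfrak u})\right|$. For $\boldsymbol g\in G_m^d$, $B_{\boldsymbol\gamma}(\boldsymbol g,f)=\sum_{\emptyset\ne\mathfrak u\subseteq[d]}\gamma_{\mathfrak u}\prod_{i\in\mathfrak u}(b_i-a_i)\,E(\mathcal P(\boldsymbol g,f),\mathfrak u)$. *)

theory Defs
  imports
    Complex_Main
    "HOL-Library.Z2"
    "HOL-Library.FuncSet"
    "HOL-Library.Multiset"
    "HOL-Computational_Algebra.Computational_Algebra"
begin

text \<open>
  The field \<open>F\<^sub>2\<close> is the type \<^typ>\<open>bit\<close>. Vectors indexed by \<open>{1..d}\<close> are functions on \<^typ>\<open>nat\<close>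
  of which only the values on \<open>{1..d}\<close> are used.
\<close>

definition G :: "nat \<Rightarrow> bit poly set" where
  "G m = {h. h = 0 \<or> degree h < m}"

lemma finite_G: "finite (G m)"
proof (rule finite_subset)
  show "G m \<subseteq> Poly ` {xs. set xs \<subseteq> {0, 1} \<and> length xs \<le> m}"
  proof
    fix h assume "h \<in> G m"
    hence "length (coeffs h) \<le> m"
      by (cases "h = 0") (auto simp: G_def length_coeffs)
    moreover have "set (coeffs h) \<subseteq> {0, 1}"
      by (metis bit_not_zero_iff insertCI subsetI)
    ultimately show "h \<in> Poly ` {xs. set xs \<subseteq> {0, 1} \<and> length xs \<le> m}"
      by (intro image_eqI[of _ _ "coeffs h"]) simp_all
  qed
  show "finite (Poly ` {xs :: bit list. set xs \<subseteq> {0, 1} \<and> length xs \<le> m})"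
    by (intro finite_imageI finite_lists_length_le) simp
qed

text \<open>
  A series \<open>\<Sum>k\<ge>w. a\<^sub>k x\<^sup>-\<^sup>k\<close> in \<open>F\<^sub>2((x\<^sup>-\<^sup>1))\<close> is a \<^typ>\<open>bit fls\<close> whose formal variable \<^const>\<open>fls_X\<close>
  stands for \<open>x\<^sup>-\<^sup>1\<close>; its coefficient \<open>a\<^sub>k\<close> is the one at index \<open>k\<close>, and \<open>x\<close> itself is \<^const>\<open>fls_X_inv\<close>.
\<close>

definition laurent_of_poly :: "bit poly \<Rightarrow> bit fls" where
  "laurent_of_poly p = poly (map_poly fls_const p) fls_X_inv"

text \<open>
  Coefficients below the order of the series vanish, so the sum may always start at \<open>1\<close>.
\<close>

definition trunc_eval :: "nat \<Rightarrow> bit fls \<Rightarrow> real" where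
  "trunc_eval m g = (\<Sum>k = 1..m. of_bool (fls_nth g (int k) = 1) / 2 ^ k)"

definition poly_lattice_point ::
    "nat \<Rightarrow> nat \<Rightarrow> (nat \<Rightarrow> bit poly) \<Rightarrow> bit poly \<Rightarrow> bit poly \<Rightarrow> (nat \<Rightarrow> real)" where
  "poly_lattice_point m d g f h =
     (\<lambda>i\<in>{1..d}. trunc_eval m (laurent_of_poly (h * g i) / laurent_of_poly f))"

definition poly_lattice ::
    "nat \<Rightarrow> nat \<Rightarrow> (nat \<Rightarrow> bit poly) \<Rightarrow> bit poly \<Rightarrow> (nat \<Rightarrow> real) multiset" where
  "poly_lattice m d g f = image_mset (poly_lattice_point m d g f) (mset_set (G m))"

text \<open>
  The digit \<open>\<xi>\<^sub>j\<close> of the dyadic expansion \<open>x = \<xi>\<^sub>1/2 + \<xi>\<^sub>2/2\<^sup>2 + \<dots>\<close> having infinitely many digits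
  different from \<open>1\<close>; that these digits do form that expansion is checked in the two lemmas below.
\<close>

definition dyadic_digit :: "real \<Rightarrow> nat \<Rightarrow> nat" where
  "dyadic_digit x j = nat (\<lfloor>2 ^ j * x\<rfloor> mod 2)"

lemma dyadic_digit_eq:
  "real (dyadic_digit x (Suc n)) = real_of_int \<lfloor>2 ^ Suc n * x\<rfloor> - 2 * real_of_int \<lfloor>2 ^ n * x\<rfloor>"
proof -
  have "\<lfloor>2 ^ Suc n * x\<rfloor> div 2 = \<lfloor>2 ^ n * x\<rfloor>"
    using floor_divide_real_eq_div[of 2 "2 ^ Suc n * x"] by simp
  hence "\<lfloor>2 ^ Suc n * x\<rfloor> mod 2 = \<lfloor>2 ^ Suc n * x\<rfloor> - 2 * \<lfloor>2 ^ n * x\<rfloor>"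
    by (metis minus_mult_div_eq_mod)
  moreover have "int (dyadic_digit x (Suc n)) = \<lfloor>2 ^ Suc n * x\<rfloor> mod 2"
    unfolding dyadic_digit_def by simp
  ultimately have "int (dyadic_digit x (Suc n)) = \<lfloor>2 ^ Suc n * x\<rfloor> - 2 * \<lfloor>2 ^ n * x\<rfloor>"
    by simp
  thus ?thesis
    by linarith
qed

lemma dyadic_digit_sums:
  assumes "0 \<le> x" "x < 1"
  shows "(\<lambda>j. real (dyadic_digit x (Suc j)) / 2 ^ Suc j) sums x"
proof -
  have partial: "(\<Sum>j<n. real (dyadic_digit x (Suc j)) / 2 ^ Suc j) = real_of_int \<lfloor>2 ^ n * x\<rfloor> / 2 ^ n"
    for n
  proof (induction n)
    case 0
    have "\<lfloor>x\<rfloor> = 0" using assms by linarith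
    then show ?case by simp
  next
    case (Suc n)
    have "(\<Sum>j<Suc n. real (dyadic_digit x (Suc j)) / 2 ^ Suc j)
        = real_of_int \<lfloor>2 ^ n * x\<rfloor> / 2 ^ n + real (dyadic_digit x (Suc n)) / 2 ^ Suc n"
      using Suc by simp
    also have "\<dots> = real_of_int \<lfloor>2 ^ Suc n * x\<rfloor> / 2 ^ Suc n"
      unfolding dyadic_digit_eq by (simp add: field_simps)
    finally show ?case .
  qed
  have "(\<lambda>n. real_of_int \<lfloor>2 ^ n * x\<rfloor> / 2 ^ n) \<longlonglongrightarrow> x"
  proof (rule tendsto_sandwich)
    show "\<forall>\<^sub>F n in sequentially. x - (1 / 2) ^ n \<le> real_of_int \<lfloor>2 ^ n * x\<rfloor> / 2 ^ n"
    proof (intro always_eventually allI)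
      fix n
      have "2 ^ n * x - 1 \<le> real_of_int \<lfloor>2 ^ n * x\<rfloor>" by linarith
      hence "(2 ^ n * x - 1) / 2 ^ n \<le> real_of_int \<lfloor>2 ^ n * x\<rfloor> / 2 ^ n"
        by (intro divide_right_mono) simp_all
      thus "x - (1 / 2) ^ n \<le> real_of_int \<lfloor>2 ^ n * x\<rfloor> / 2 ^ n"
        by (simp add: diff_divide_distrib power_one_over)
    qed
    show "\<forall>\<^sub>F n in sequentially. real_of_int \<lfloor>2 ^ n * x\<rfloor> / 2 ^ n \<le> x"
    proof (intro always_eventually allI)
      fix n
      have "real_of_int \<lfloor>2 ^ n * x\<rfloor> \<le> 2 ^ n * x" by linarith
      thus "real_of_int \<lfloor>2 ^ n * x\<rfloor> / 2 ^ n \<le> x"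
        by (simp add: field_simps)
    qed
    have "(\<lambda>n. x - (1 / 2) ^ n) \<longlonglongrightarrow> x - 0"
      by (intro tendsto_diff tendsto_const LIMSEQ_power_zero) simp
    thus "(\<lambda>n. x - (1 / 2) ^ n) \<longlonglongrightarrow> x" by simp
  qed simp
  thus ?thesis
    unfolding sums_def partial .
qed

lemma infinite_dyadic_digit_neq_1: "infinite {j. dyadic_digit x j \<noteq> 1}"
proof
  assume "finite {j. dyadic_digit x j \<noteq> 1}"
  then obtain N where N: "\<And>j. dyadic_digit x j \<noteq> 1 \<Longrightarrow> j \<le> N"
    unfolding finite_nat_set_iff_bounded_le by blast
  define r where "r n = 1 - frac (2 ^ n * x)" for n :: nat
  have step: "r (Suc n) = 2 * r n" if "n \<ge> N" for n
  proof -
    have "dyadic_digit x (Suc n) = 1" using N[of "Suc n"] that by force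
    thus ?thesis
      using dyadic_digit_eq[of x n] by (simp add: r_def frac_def)
  qed
  have r: "r (N + k) = 2 ^ k * r N" for k
    by (induction k) (simp_all add: step)
  have "r N > 0" by (simp add: r_def frac_lt_1)
  moreover obtain k where "1 / r N < 2 ^ k"
    using real_arch_pow[of 2 "1 / r N"] by auto
  ultimately have "1 < r (N + k)"
    by (simp add: r field_simps)
  moreover have "r (N + k) \<le> 1" by (simp add: r_def)
  ultimately show False by simp
qed

definition mu :: "nat \<Rightarrow> nat" where
  "mu k = (if k = 0 then 0 else (THE l. 2 ^ (l - 1) \<le> k \<and> k < 2 ^ l))"

lemma mu_eqI:
  assumes "2 ^ (l - 1) \<le> k" "k < 2 ^ l"
  shows "mu k = l"
proof -
  have "l' = l" if "2 ^ (l' - 1) \<le> k" "k < 2 ^ l'" for l'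
  proof -
    have "(2::nat) ^ (l' - 1) < 2 ^ l" "(2::nat) ^ (l - 1) < 2 ^ l'"
      using assms that by linarith+
    hence "l' - 1 < l" "l - 1 < l'" by simp_all
    thus ?thesis by simp
  qed
  hence "(THE l. 2 ^ (l - 1) \<le> k \<and> k < 2 ^ l) = l"
    using assms by blast
  moreover have "k \<noteq> 0" using assms(1) by (intro notI) simp
  ultimately show ?thesis by (simp add: mu_def)
qed

text \<open>
  The binary expansion of \<open>k\<close> has exactly \<open>mu k\<close> digits \<open>\<kappa>\<^sub>j = k div 2 ^ j mod 2\<close>.
\<close>

definition wal :: "nat \<Rightarrow> real \<Rightarrow> real" where
  "wal k x = (-1) ^ (\<Sum>j<mu k. (k div 2 ^ j mod 2) * dyadic_digit x (Suc j))"

definition mu_vec :: "nat set \<Rightarrow> (nat \<Rightarrow> nat) \<Rightarrow> nat" where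
  "mu_vec u k = (\<Sum>i\<in>u. mu (k i))"

definition wal_vec :: "nat set \<Rightarrow> (nat \<Rightarrow> nat) \<Rightarrow> (nat \<Rightarrow> real) \<Rightarrow> real" where
  "wal_vec u k y = (\<Prod>i\<in>u. wal (k i) (y i))"

definition E :: "nat \<Rightarrow> (nat \<Rightarrow> real) multiset \<Rightarrow> nat set \<Rightarrow> real" where
  "E m P u =
     (\<Sum>k \<in> (\<Pi>\<^sub>E i\<in>u. {1..2 ^ m - 1}).
        1 / 2 ^ mu_vec u k * \<bar>1 / 2 ^ m * (\<Sum>y\<in>#P. wal_vec u k y)\<bar>)"

definition B ::
    "nat \<Rightarrow> (nat set \<Rightarrow> real) \<Rightarrow> (nat \<Rightarrow> real) \<Rightarrow> (nat \<Rightarrow> real) \<Rightarrow>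
     nat \<Rightarrow> (nat \<Rightarrow> bit poly) \<Rightarrow> bit poly \<Rightarrow> real" where
  "B m \<gamma> a b d g f =
     (\<Sum>u \<in> {u. u \<noteq> {} \<and> u \<subseteq> {1..d}}.
        \<gamma> u * (\<Prod>i\<in>u. b i - a i) * E m (poly_lattice m d g f) u)"

end

theory Submission
  imports Defs
begin

text \<open>
  The Walsh function \<open>wal k\<close> evaluated along a polynomial lattice is a character
  \<open>h \<mapsto> (-1)\<^bsup>res f (h * q)\<^esup>\<close> of the additive group \<open>G m\<close>, where \<open>res f (h * q)\<close> is the coefficient of \<open>x\<^sup>-\<^sup>1\<close> in
  \<open>h * q / f\<close> and \<open>q = \<Sum>i\<in>u. g i * digit_poly (k i)\<close>. The character is trivial iff \<open>f\<close> divides \<open>q\<close>, so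
  \<open>E m P u\<close> sums the weights \<open>2\<^bsup>-mu_vec u k\<^esup>\<close> over the dual lattice. The mean over \<open>g d \<in> G m\<close> of the
  terms of \<open>B\<close> with \<open>d \<in> u\<close> is at most the claimed bound, as each \<open>k\<close> is hit by at most one \<open>g d\<close>, and the
  minimum does not exceed the mean; the other terms are those of dimension \<open>d - 1\<close>.
\<close>

subsection \<open>Polynomials as Laurent series\<close>

lemma laurent_of_poly_pCons:
  "laurent_of_poly (pCons c p) = fls_const c + fls_X_inv * laurent_of_poly p"
  unfolding laurent_of_poly_def by (cases "c = 0 \<and> p = 0") (auto simp: map_poly_pCons)

lemma laurent_of_poly_0 [simp]: "laurent_of_poly 0 = 0"
  by (simp add: laurent_of_poly_def)

lemma fls_nth_laurent_of_poly:
  "fls_nth (laurent_of_poly p) n = (if n \<le> 0 then coeff p (nat (- n)) else 0)"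
proof (induction p arbitrary: n)
  case 0
  then show ?case by simp
next
  case (pCons c p)
  have "nat (- n) = Suc (nat (- (n + 1)))" if "n < 0" using that by simp
  then show ?case
    by (auto simp: laurent_of_poly_pCons fls_X_inv_times_conv_shift pCons.IH coeff_pCons
        split: nat.splits)
qed

lemma laurent_of_poly_add: "laurent_of_poly (p + q) = laurent_of_poly p + laurent_of_poly q"
  by (rule fls_eqI) (simp add: fls_nth_laurent_of_poly)

lemma laurent_of_poly_sum: "laurent_of_poly (\<Sum>i\<in>A. p i) = (\<Sum>i\<in>A. laurent_of_poly (p i))"
  by (induction A rule: infinite_finite_induct) (simp_all add: laurent_of_poly_add)

lemma laurent_of_poly_monom: "laurent_of_poly (monom c n) = fls_const c * fls_X_inv ^ n"
  by (rule fls_eqI) (auto simp: fls_nth_laurent_of_poly coeff_monom)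

lemma laurent_of_poly_smult: "laurent_of_poly (smult c p) = fls_const c * laurent_of_poly p"
  by (rule fls_eqI) (simp add: fls_nth_laurent_of_poly)

lemma laurent_of_poly_mult: "laurent_of_poly (p * q) = laurent_of_poly p * laurent_of_poly q"
  by (induction p)
    (simp_all add: laurent_of_poly_pCons laurent_of_poly_add laurent_of_poly_smult algebra_simps
      mult_pCons_left)

lemma laurent_of_poly_eq_0_iff [simp]: "laurent_of_poly p = 0 \<longleftrightarrow> p = 0"
proof
  assume "laurent_of_poly p = 0"
  hence "coeff p n = 0" for n
    using fls_nth_laurent_of_poly[of p "- int n"] by simp
  thus "p = 0" by (simp add: poly_eq_iff)
qed simp

lemma fls_subdegree_laurent_of_poly:
  assumes "p \<noteq> 0"
  shows "fls_subdegree (laurent_of_poly p) = - int (degree p)"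
proof (rule fls_subdegree_eqI)
  show "fls_nth (laurent_of_poly p) (- int (degree p)) \<noteq> 0"
    unfolding fls_nth_laurent_of_poly using assms
    by (metis le_add_same_cancel1 leading_coeff_neq_0 minus_minus nat_int neg_le_0_iff_le of_nat_0_le_iff)
qed (auto simp: fls_nth_laurent_of_poly intro!: coeff_eq_0)

section \<open>The finite additive group \<open>G m\<close> in characteristic 2\<close>

lemma add_mem_G: "p \<in> G m \<Longrightarrow> q \<in> G m \<Longrightarrow> p + q \<in> G m"
  by (cases "p = 0"; cases "q = 0") (auto simp: G_def degree_add_less)

lemma bit_poly_2_eq_0 [simp]: "(2 :: bit poly) = 0"
  by (simp add: numeral_poly)

lemma bit_poly_add_self: "p + p = (0 :: bit poly)"
  by (simp flip: mult_2)

lemma card_G: "card (G m) = 2 ^ m"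
proof (induction m)
  case 0
  have "G 0 = {0}" by (auto simp: G_def)
  then show ?case by simp
next
  case (Suc m)
  have "G (Suc m) = (\<lambda>(c, p). pCons c p) ` ({0, 1} \<times> G m)"
  proof (intro equalityI subsetI)
    fix p assume "p \<in> G (Suc m)"
    moreover obtain c q where "p = pCons c q" by (cases p)
    moreover have "c \<in> {0, 1}" by (cases c) auto
    ultimately have "(c, q) \<in> {0, 1} \<times> G m" "p = pCons c q"
      by (cases "q = 0"; auto simp: G_def)+
    thus "p \<in> (\<lambda>(c, p). pCons c p) ` ({0, 1} \<times> G m)" by force
  next
    fix p assume "p \<in> (\<lambda>(c, p). pCons c p) ` ({0, 1} \<times> G m)"
    then obtain c q where "p = pCons c q" "q \<in> G m" by auto
    thus "p \<in> G (Suc m)" by (cases "q = 0") (auto simp: G_def)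
  qed
  moreover have "inj_on (\<lambda>(c, p). pCons c p :: bit poly) ({0, 1} \<times> G m)"
    by (auto simp: inj_on_def)
  ultimately have "card (G (Suc m)) = card ({0, 1 :: bit} \<times> G m)"
    using card_image by metis
  thus ?case by (simp add: card_cartesian_product Suc)
qed

subsection \<open>The character sum of a polynomial lattice\<close>

text \<open>The nontrivial additive character of the two-element field.\<close>

definition sign :: "bit \<Rightarrow> real" where
  "sign c = (if c = 0 then 1 else -1)"

lemma sign_simps [simp]: "sign 0 = 1" "sign 1 = -1"
  by (simp_all add: sign_def)

lemma sign_add: "sign (c + d) = sign c * sign d"
  by (cases c; cases d) simp_all

lemma sign_sum: "sign (\<Sum>i\<in>A. c i) = (\<Prod>i\<in>A. sign (c i))"
  by (induction A rule: infinite_finite_induct)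
    (simp_all only: sum.infinite sum.empty sum.insert prod.infinite prod.empty prod.insert
      sign_simps sign_add simp_thms)

lemma sign_of_nat: "sign (of_nat n) = (-1) ^ n"
  by (induction n) (simp_all only: of_nat_0 of_nat_Suc sign_simps sign_add power_0 power_Suc)

text \<open>Index 1 carries the coefficient of 1/x: this is the residue of \<open>q / f\<close> at
  infinity, whose usual sign is invisible over \<open>bit\<close>.\<close>

definition res :: "bit poly \<Rightarrow> bit poly \<Rightarrow> bit" where
  "res f q = fls_nth (laurent_of_poly q / laurent_of_poly f) 1"

lemma res_add: "res f (p + q) = res f p + res f q"
  by (simp add: res_def laurent_of_poly_add add_divide_distrib)

lemma res_sum: "res f (\<Sum>i\<in>A. p i) = (\<Sum>i\<in>A. res f (p i))"
  by (induction A rule: infinite_finite_induct) (simp_all add: res_add, simp_all add: res_def)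

text \<open>The quotient is a polynomial and has no coefficient at a positive index. Hence
  \<open>res f\<close> depends only on the class modulo \<open>f\<close>.\<close>

lemma res_mult_self:
  assumes "f \<noteq> 0"
  shows "res f (f * q) = 0"
  using assms by (simp add: res_def laurent_of_poly_mult fls_nth_laurent_of_poly)

text \<open>Nondegeneracy of the residue pairing: a suitable monomial moves the leading term of the
  nonzero remainder of \<open>q\<close>, divided by \<open>f\<close>, exactly to 1/x.\<close>

lemma ex_res_eq_1:
  assumes "f \<noteq> 0" and "\<not> f dvd q"
  obtains h where "h \<in> G (degree f)" and "res f (h * q) = 1"
proof -
  define r where "r = q mod f"
  have r: "r \<noteq> 0" using assms by (simp add: r_def dvd_eq_mod_eq_0)
  have "degree f \<noteq> 0"
  proof
    assume "degree f = 0"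
    then obtain c where "f = [:c:]" by (rule degree_eq_zeroE)
    hence "f = 1" using assms(1) by (cases c) (simp_all add: one_pCons)
    thus False using assms(2) by simp
  qed
  hence deg: "degree r < degree f" using assms(1) r degree_mod_less[of f q] by (auto simp: r_def)
  \<comment> \<open>This exponent gives \<open>h * r\<close> degree
    \<open>degree f - 1\<close>.\<close>
  define e where "e = degree f - 1 - degree r"
  define h :: "bit poly" where "h = monom 1 e"
  have h: "h \<noteq> 0" "degree h = e" by (simp_all add: h_def degree_monom_eq)
  have "q = f * (q div f) + r" by (simp add: r_def)
  moreover have "h * (f * (q div f) + r) = f * (h * (q div f)) + h * r"
    by (simp add: algebra_simps)
  ultimately have "h * q = f * (h * (q div f)) + h * r" by argo
  hence res_eq: "res f (h * q) = res f (h * r)"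
    by (simp only: res_add res_mult_self[OF assms(1)] add_0)
  have "fls_subdegree (laurent_of_poly (h * r) / laurent_of_poly f) = 1"
    using r h assms(1) deg
    by (simp add: fls_divide_subdegree fls_subdegree_laurent_of_poly degree_mult_eq e_def)
  moreover from this have "laurent_of_poly (h * r) / laurent_of_poly f \<noteq> 0"
    by (metis fls_zero_subdegree zero_neq_one)
  ultimately have "res f (h * r) \<noteq> 0"
    unfolding res_def by (metis nth_fls_subdegree_nonzero)
  hence "res f (h * q) = 1" by (simp add: res_eq)
  moreover have "h \<in> G (degree f)" using deg by (simp add: G_def h e_def)
  ultimately show thesis by (rule that[rotated])
qed

text \<open>Orthogonality of characters: a nontrivial one takes the value -1 at some
  \<open>h0\<close>, and translation by \<open>h0\<close> turns the sum into its own
  negative.\<close>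

lemma sum_sign_res:
  assumes "f \<noteq> 0"
  shows "(\<Sum>h\<in>G (degree f). sign (res f (h * q))) = 2 ^ degree f * of_bool (f dvd q)"
proof (cases "f dvd q")
  case True
  then obtain p where "q = f * p" by blast
  hence "sign (res f (h * q)) = 1" for h
    using res_mult_self[OF assms, of "h * p"] by (simp add: mult.left_commute sign_def)
  thus ?thesis using True by (simp add: card_G)
next
  case False
  then obtain h0 where h0: "h0 \<in> G (degree f)" "res f (h0 * q) = 1"
    using ex_res_eq_1 assms by blast
  have "(\<Sum>h\<in>G (degree f). sign (res f (h * q))) = (\<Sum>h\<in>G (degree f). sign (res f ((h + h0) * q)))"
    \<comment> \<open>In characteristic 2 the translation is its own inverse.\<close>
    by (rule sum.reindex_bij_witness[of _ "\<lambda>h. h + h0" "\<lambda>h. h + h0"])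
      (auto simp: add.assoc bit_poly_add_self intro: add_mem_G h0)
  also have "\<dots> = - (\<Sum>h\<in>G (degree f). sign (res f (h * q)))"
    by (simp only: distrib_right res_add sign_add h0(2) sign_simps mult_minus1_right sum_negf)
  finally have "(\<Sum>h\<in>G (degree f). sign (res f (h * q))) = 0"
    by (rule equal_neg_zero[THEN iffD1])
  thus ?thesis using False by (simp only: of_bool_eq mult_zero_right)
qed

section \<open>Binary digits of truncated series\<close>

lemma binary_sum_less_1: "(\<Sum>k<m. of_bool (c k) / 2 ^ Suc k :: real) < 1"
proof -
  have "(\<Sum>k<m. of_bool (c k) / 2 ^ Suc k :: real) \<le> (\<Sum>k<m. 1 / 2 ^ Suc k)"
    by (intro sum_mono) (simp add: divide_right_mono)
  also have "\<dots> = 1 - 1 / 2 ^ m"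
    by (induction m) (simp_all add: field_simps)
  finally show ?thesis by (simp add: order_le_less_trans)
qed

text \<open>Induction on \<open>m\<close>: doubling the number exposes the first digit as its
  integer part and shifts all the others by one place.\<close>

lemma dyadic_digit_binary_sum:
  assumes "j < m"
  shows "dyadic_digit (\<Sum>k<m. of_bool (c k) / 2 ^ Suc k) (Suc j) = of_bool (c j)"
  using assms
proof (induction m arbitrary: c j)
  case 0
  then show ?case by simp
next
  case (Suc m)
  define y :: real where "y = (\<Sum>k<m. of_bool (c (Suc k)) / 2 ^ Suc k)"
  have y: "0 \<le> y" "y < 1"
    using binary_sum_less_1[of "\<lambda>k. c (Suc k)" m] by (auto simp: y_def intro!: sum_nonneg)
  have split: "(\<Sum>k<Suc m. of_bool (c k) / 2 ^ Suc k) = (of_bool (c 0) + y) / 2"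
    by (subst sum.lessThan_Suc_shift) (simp add: y_def sum_divide_distrib add_divide_distrib mult.commute)
  show ?case
  proof (cases j)
    case 0
    have "\<lfloor>of_bool (c 0) + y\<rfloor> = of_bool (c 0)" using y by (simp add: floor_eq_iff)
    moreover have "2 ^ Suc 0 * ((of_bool (c 0) + y) / 2) = of_bool (c 0) + y" by simp
    ultimately show ?thesis unfolding split dyadic_digit_def 0 by (simp only:) simp
  next
    case (Suc i)
    \<comment> \<open>For \<open>j > 0\<close> the first digit contributes an even integer, which
      the reduction modulo 2 removes.\<close>
    have "2 ^ Suc j * ((of_bool (c 0) + y) / 2) = 2 ^ Suc i * y + of_int (2 * 2 ^ i * of_bool (c 0))"
      by (simp add: Suc field_simps)
    hence "\<lfloor>2 ^ Suc j * ((of_bool (c 0) + y) / 2)\<rfloor> = \<lfloor>2 ^ Suc i * y\<rfloor> + 2 * (2 ^ i * of_bool (c 0))"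
      by (metis floor_add_int mult.assoc)
    hence "dyadic_digit ((of_bool (c 0) + y) / 2) (Suc j) = dyadic_digit y (Suc i)"
      unfolding dyadic_digit_def by (metis mod_mult_self2)
    thus ?thesis
      using Suc.IH[of i "\<lambda>k. c (Suc k)"] Suc.prems Suc
      by (simp only: split y_def[symmetric])
  qed
qed

lemma dyadic_digit_trunc_eval:
  assumes "j < m"
  shows "dyadic_digit (trunc_eval m g) (Suc j) = of_bool (fls_nth g (int (Suc j)) = 1)"
proof -
  have "trunc_eval m g = (\<Sum>k<m. of_bool (fls_nth g (int (Suc k)) = 1) / 2 ^ Suc k)"
    unfolding trunc_eval_def
    by (rule sum.reindex_bij_witness[of _ Suc "\<lambda>k. k - 1"]) auto
  thus ?thesis using dyadic_digit_binary_sum[OF assms] by simp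
qed

lemma atLeastAtMost_power_iff: "k \<in> {1..2 ^ m - 1} \<longleftrightarrow> k \<noteq> 0 \<and> k < (2 :: nat) ^ m"
proof -
  have "(1 :: nat) \<le> 2 ^ m" by simp
  thus ?thesis unfolding atLeastAtMost_iff by linarith
qed

section \<open>Digit polynomials and Walsh functions\<close>

definition digit_poly :: "nat \<Rightarrow> bit poly" where
  "digit_poly k = (\<Sum>j<mu k. monom (of_nat (k div 2 ^ j mod 2)) j)"

lemma mu_bounds:
  assumes "k \<noteq> 0"
  shows "mu k \<ge> 1" and "2 ^ (mu k - 1) \<le> k" and "k < 2 ^ mu k"
proof -
  obtain n where n: "2 ^ n \<le> k" "k < 2 ^ (n + 1)"
    using ex_power_ivl1[of 2 k] assms by auto
  hence "mu k = Suc n" by (intro mu_eqI) auto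
  thus "mu k \<ge> 1" "2 ^ (mu k - 1) \<le> k" "k < 2 ^ mu k" using n by simp_all
qed

lemma mu_le:
  assumes "k < 2 ^ m"
  shows "mu k \<le> m"
proof (cases "k = 0")
  case True
  then show ?thesis by (simp add: mu_def)
next
  case False
  hence "(2 :: nat) ^ (mu k - 1) < 2 ^ m" using mu_bounds(2)[of k] assms by linarith
  thus ?thesis by simp
qed

lemma coeff_digit_poly:
  "coeff (digit_poly k) j = (if j < mu k then of_nat (k div 2 ^ j mod 2) else 0)"
  by (simp add: digit_poly_def coeff_sum)

text \<open>The binary digit of \<open>k\<close> at position \<open>mu k - 1\<close> is the leading
  one, hence 1.\<close>

lemma digit_poly_nonzero:
  assumes "k \<noteq> 0"
  shows "digit_poly k \<noteq> 0"
proof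
  assume "digit_poly k = 0"
  hence "coeff (digit_poly k) (mu k - 1) = 0" by simp
  moreover have "k div 2 ^ (mu k - 1) = 1"
  proof (rule div_nat_eqI)
    show "k < 2 ^ (mu k - 1) * Suc 1"
      using mu_bounds[OF assms] by (metis One_nat_def Suc_1 Suc_pred less_eq_Suc_le mult.commute power_Suc)
  qed (use mu_bounds[OF assms] in simp)
  ultimately show False using mu_bounds(1)[OF assms] by (simp add: coeff_digit_poly)
qed

lemma degree_digit_poly_less:
  assumes "k \<noteq> 0" and "k < 2 ^ m"
  shows "degree (digit_poly k) < m"
proof -
  have "degree (digit_poly k) \<le> mu k - 1"
    by (rule degree_le) (auto simp: coeff_digit_poly)
  thus ?thesis using mu_bounds(1)[OF assms(1)] mu_le[OF assms(2)] by linarith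
qed

text \<open>
  The Walsh exponent is the coefficient of \<open>x\<^sup>-\<^sup>1\<close> in the product of the digit polynomial and
  the series.
\<close>

lemma wal_trunc_eval:
  assumes "k < 2 ^ m"
  shows "wal k (trunc_eval m (laurent_of_poly p / laurent_of_poly f)) = sign (res f (p * digit_poly k))"
proof -
  define g where "g = laurent_of_poly p / laurent_of_poly f"
  have "res f (p * digit_poly k) = fls_nth (laurent_of_poly (digit_poly k) * g) 1"
    by (simp add: res_def g_def laurent_of_poly_mult mult.commute)
  \<comment> \<open>Multiplying by the \<open>j\<close>-th power of x brings index
    \<open>1 + j\<close> to index 1.\<close>
  also have "\<dots> = (\<Sum>j<mu k. of_nat (k div 2 ^ j mod 2) * fls_nth g (1 + int j))"
    by (simp add: digit_poly_def laurent_of_poly_sum laurent_of_poly_monom sum_distrib_right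
        mult.assoc fls_X_inv_power_times_conv_shift(1) fls_nth_sum)
  also have "\<dots> = (\<Sum>j<mu k. of_nat ((k div 2 ^ j mod 2) * dyadic_digit (trunc_eval m g) (Suc j)))"
  proof (rule sum.cong)
    \<comment> \<open>Since \<open>mu k \<le> m\<close>, only digits that survive the truncation are
      read.\<close>
    fix j assume "j \<in> {..<mu k}"
    hence "dyadic_digit (trunc_eval m g) (Suc j) = of_bool (fls_nth g (1 + int j) = 1)"
      using dyadic_digit_trunc_eval[of j m g] mu_le[OF assms] by simp
    thus "of_nat (k div 2 ^ j mod 2) * fls_nth g (1 + int j)
        = of_nat ((k div 2 ^ j mod 2) * dyadic_digit (trunc_eval m g) (Suc j))"
      by (cases "fls_nth g (1 + int j)") simp_all
  qed simp
  also have "\<dots> = of_nat (\<Sum>j<mu k. (k div 2 ^ j mod 2) * dyadic_digit (trunc_eval m g) (Suc j))"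
    by simp
  finally show ?thesis unfolding g_def[symmetric] by (simp add: wal_def sign_of_nat del: of_nat_sum)
qed

subsection \<open>The figure of merit\<close>

text \<open>Additivity of \<open>res\<close> merges the product of Walsh values into a single
  character of \<open>h\<close>. Its mean is 0 or 1 by orthogonality, so the absolute value
  disappears.\<close>

lemma E_poly_lattice:
  assumes "f \<noteq> 0" and "degree f = m" and "u \<subseteq> {1..d}"
  shows "E m (poly_lattice m d g f) u =
    (\<Sum>k \<in> (\<Pi>\<^sub>E i\<in>u. {1..2 ^ m - 1}).
       1 / 2 ^ mu_vec u k * of_bool (f dvd (\<Sum>i\<in>u. g i * digit_poly (k i))))"
  unfolding E_def
proof (rule sum.cong)
  fix k assume k: "k \<in> (\<Pi>\<^sub>E i\<in>u. {1..(2::nat) ^ m - 1})"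
  have "(\<Sum>y\<in>#poly_lattice m d g f. wal_vec u k y) = (\<Sum>h\<in>G m. wal_vec u k (poly_lattice_point m d g f h))"
    by (simp add: poly_lattice_def sum_unfold_sum_mset image_mset.compositionality comp_def)
  also have "\<dots> = (\<Sum>h\<in>G m. sign (res f (h * (\<Sum>i\<in>u. g i * digit_poly (k i)))))"
  proof (rule sum.cong)
    fix h
    have "wal (k i) (poly_lattice_point m d g f h i) = sign (res f (h * (g i * digit_poly (k i))))"
      if "i \<in> u" for i
    proof -
      have "k i \<in> {1..2 ^ m - 1}" using k that by auto
      hence "k i < 2 ^ m" by (simp only: atLeastAtMost_power_iff)
      thus ?thesis
        using that assms(3) by (auto simp: poly_lattice_point_def wal_trunc_eval mult.assoc)
    qed
    thus "wal_vec u k (poly_lattice_point m d g f h) = sign (res f (h * (\<Sum>i\<in>u. g i * digit_poly (k i))))"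
      by (simp add: wal_vec_def sum_distrib_left res_sum sign_sum)
  qed simp
  also have "\<dots> = 2 ^ m * of_bool (f dvd (\<Sum>i\<in>u. g i * digit_poly (k i)))"
    using sum_sign_res[OF assms(1)] assms(2) by simp
  finally have eq: "(\<Sum>y\<in>#poly_lattice m d g f. wal_vec u k y)
      = 2 ^ m * of_bool (f dvd (\<Sum>i\<in>u. g i * digit_poly (k i)))" .
  show "1 / 2 ^ mu_vec u k * \<bar>1 / 2 ^ m * (\<Sum>y\<in>#poly_lattice m d g f. wal_vec u k y)\<bar>
      = 1 / 2 ^ mu_vec u k * of_bool (f dvd (\<Sum>i\<in>u. g i * digit_poly (k i)))"
    unfolding eq by simp
qed simp

text \<open>Each dyadic block from \<open>2 ^ m\<close> to below \<open>2 ^ Suc m\<close> has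
  \<open>2 ^ m\<close> terms equal to \<open>1 / 2 ^ Suc m\<close>, so it adds 1/2.\<close>

lemma sum_inverse_power_mu: "(\<Sum>k = 1..2 ^ m - 1. 1 / 2 ^ mu k :: real) = real m / 2"
proof (induction m)
  case 0
  then show ?case by simp
next
  case (Suc m)
  have "{1..2 ^ Suc m - 1} = {1..2 ^ m - 1} \<union> {2 ^ m..<2 ^ Suc m :: nat}"
    by (intro set_eqI) (simp only: Un_iff atLeastAtMost_power_iff atLeastLessThan_iff, auto)
  moreover have "{1..2 ^ m - 1} \<inter> {2 ^ m..<2 ^ Suc m :: nat} = {}"
    by (auto simp: Suc_le_eq)
  ultimately have "(\<Sum>k = 1..2 ^ Suc m - 1. 1 / 2 ^ mu k :: real)
      = (\<Sum>k = 1..2 ^ m - 1. 1 / 2 ^ mu k) + (\<Sum>k \<in> {2 ^ m..<2 ^ Suc m}. 1 / 2 ^ mu k)"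
    by (simp add: sum.union_disjoint del: power_Suc)
  also note Suc
  also have "(\<Sum>k \<in> {2 ^ m..<2 ^ Suc m}. 1 / 2 ^ mu k :: real) = (\<Sum>k \<in> {2 ^ m..<2 ^ Suc m :: nat}. 1 / 2 ^ Suc m)"
    by (intro sum.cong refl, subst mu_eqI[of "Suc m"]) simp_all
  also have "\<dots> = 1 / 2" by simp
  finally show ?case by (simp add: field_simps)
qed

lemma sum_inverse_power_mu_vec:
  assumes "finite u"
  shows "(\<Sum>k \<in> (\<Pi>\<^sub>E i\<in>u. {1..2 ^ m - 1}). 1 / 2 ^ mu_vec u k :: real) = (real m / 2) ^ card u"
proof -
  have "(\<Sum>k \<in> (\<Pi>\<^sub>E i\<in>u. {1..2 ^ m - 1}). 1 / 2 ^ mu_vec u k :: real)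
      = (\<Sum>k \<in> (\<Pi>\<^sub>E i\<in>u. {1..2 ^ m - 1}). \<Prod>i\<in>u. 1 / 2 ^ mu (k i))"
    by (simp add: mu_vec_def power_sum prod_dividef)
  also have "\<dots> = (\<Prod>i\<in>u. \<Sum>k = 1..2 ^ m - 1. 1 / 2 ^ mu k)"
    using assms by (intro prod_sum_PiE[symmetric]) simp_all
  finally show ?thesis by (simp only: sum_inverse_power_mu prod_constant)
qed

text \<open>Over a field the irreducible \<open>f\<close> is prime, and both factors are nonzero of
  degree below that of \<open>f\<close>.\<close>

lemma not_dvd_mult_digit_poly:
  assumes "irreducible f" and "h \<in> G (degree f)" and "h \<noteq> 0" and "k \<in> {1..2 ^ degree f - 1}"
  shows "\<not> f dvd h * digit_poly k"
proof
  assume "f dvd h * digit_poly k"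
  moreover have "prime_elem f" using assms(1) by (rule field_poly_irreducible_imp_prime)
  ultimately consider "f dvd h" | "f dvd digit_poly k"
    using prime_elem_dvd_mult_iff by blast
  thus False
  proof cases
    case 1
    thus ?thesis using assms(2,3) dvd_imp_degree_le[of f h] by (auto simp: G_def)
  next
    case 2
    have "k < 2 ^ degree f"
      using assms(4) by (simp only: atLeastAtMost_power_iff)
    thus ?thesis
      using 2 assms(4) digit_poly_nonzero[of k] degree_digit_poly_less[of k "degree f"]
        dvd_imp_degree_le[of f "digit_poly k"] by auto
  qed
qed

text \<open>
  Averaging over one component: since \<open>digit_poly (k j)\<close> is invertible modulo \<open>f\<close>, each frequency
  vector \<open>k\<close> lies in the dual lattice for at most one choice of the component \<open>j\<close>.
\<close>

lemma sum_E_le: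
  assumes f: "irreducible f" "degree f = m" and u: "u \<subseteq> {1..d}" "j \<in> u"
  shows "(\<Sum>h\<in>G m. E m (poly_lattice m d (g(j := h)) f) u) \<le> (real m / 2) ^ card u"
proof -
  have f0: "f \<noteq> 0" using f(1) by auto
  have fin: "finite u" using u(1) finite_subset by blast
  define D where "D k h \<longleftrightarrow> f dvd (\<Sum>i\<in>u. (g(j := h)) i * digit_poly (k i))" for k h
  have "(\<Sum>h\<in>G m. of_bool (D k h)) \<le> (1 :: real)" if k: "k \<in> (\<Pi>\<^sub>E i\<in>u. {1..2 ^ m - 1})" for k
  proof -
    have "h = h'" if h: "h \<in> G m" "h' \<in> G m" "D k h" "D k h'" for h h'
    proof (rule ccontr)
      assume "h \<noteq> h'"
      \<comment> \<open>Only the \<open>j\<close>-th summand depends on \<open>x\<close>; the rest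
        cancels in the difference for two candidates.\<close>
      have *: "(\<Sum>i\<in>u. (g(j := x)) i * digit_poly (k i))
          = x * digit_poly (k j) + (\<Sum>i\<in>u - {j}. g i * digit_poly (k i))" for x
        using fin u(2) by (subst sum.remove[of u j]) (auto intro!: sum.cong)
      have "f dvd (h - h') * digit_poly (k j)"
        using dvd_diff[OF h(3)[unfolded D_def *] h(4)[unfolded D_def *]] by (simp add: algebra_simps)
      moreover have "h - h' = h + h'" by (simp add: poly_eq_iff)
      hence "h - h' \<in> G m" using h(1,2) by (simp only: add_mem_G)
      ultimately show False
        using not_dvd_mult_digit_poly[of f "h - h'" "k j"] f \<open>h \<noteq> h'\<close> PiE_mem[OF k u(2)]
        by (simp only: right_minus_eq not_False_eq_True simp_thms)
    qed
    hence "card {h \<in> G m. D k h} \<le> 1"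
      by (auto simp: card_le_Suc0_iff_eq finite_G)
    thus ?thesis by (simp add: of_bool_def sum.If_cases finite_G Int_def flip: Collect_conj_eq)
  qed
  hence "(\<Sum>k \<in> (\<Pi>\<^sub>E i\<in>u. {1..2 ^ m - 1}). 1 / 2 ^ mu_vec u k * (\<Sum>h\<in>G m. of_bool (D k h)))
      \<le> (\<Sum>k \<in> (\<Pi>\<^sub>E i\<in>u. {1..2 ^ m - 1}). 1 / 2 ^ mu_vec u k * (1 :: real))"
    by (intro sum_mono mult_left_mono) simp_all
  moreover have "(\<Sum>h\<in>G m. E m (poly_lattice m d (g(j := h)) f) u)
      = (\<Sum>k \<in> (\<Pi>\<^sub>E i\<in>u. {1..2 ^ m - 1}). 1 / 2 ^ mu_vec u k * (\<Sum>h\<in>G m. of_bool (D k h)))"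
    unfolding E_poly_lattice[OF f0 f(2) u(1)] D_def sum_distrib_left by (rule sum.swap)
  ultimately show ?thesis by (simp only: sum_inverse_power_mu_vec[OF fin] mult_1_right)
qed

text \<open>The dual-lattice formula involves only the components in \<open>u\<close>. This carries
  terms of dimension \<open>d\<close> over to dimension \<open>Suc d\<close>.\<close>

lemma E_poly_lattice_eqI:
  assumes "f \<noteq> 0" and "degree f = m" and "u \<subseteq> {1..d}" and "u \<subseteq> {1..d'}"
    and "\<And>i. i \<in> u \<Longrightarrow> g i = g' i"
  shows "E m (poly_lattice m d g f) u = E m (poly_lattice m d' g' f) u"
  using assms by (simp add: E_poly_lattice cong: sum.cong)

text \<open>For a first component 1 the dual condition reads \<open>f dvd digit_poly (k 1)\<close>,
  which the degrees exclude.\<close>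

lemma E_poly_lattice_1:
  assumes "irreducible f" and "degree f = m" and "m \<ge> 1" and "g 1 = 1"
  shows "E m (poly_lattice m 1 g f) {1} = 0"
proof -
  have "\<not> f dvd digit_poly k" if "k \<in> {1..2 ^ m - 1}" for k
    using not_dvd_mult_digit_poly[of f 1 k] assms that by (simp add: G_def)
  hence not_dvd: "f dvd (\<Sum>i\<in>{1}. g i * digit_poly (k i)) \<longleftrightarrow> False" if "k \<in> {1} \<rightarrow>\<^sub>E {1..2 ^ m - 1}" for k
    using PiE_mem[OF that, of 1] assms(4) by force
  have "f \<noteq> 0" "{1} \<subseteq> {1..1 :: nat}" using assms(1) by auto
  note eq = E_poly_lattice[OF this(1) assms(2) this(2)]
  show ?thesis
    unfolding eq by (rule sum.neutral, intro ballI) (simp only: not_dvd of_bool_eq mult_zero_right)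
qed

section \<open>The component-by-component induction\<close>

lemma subsets_Suc_eq:
  "{u. u \<noteq> {} \<and> u \<subseteq> {1..Suc d}}
    = {u. u \<noteq> {} \<and> u \<subseteq> {1..d}} \<union> {u. u \<subseteq> {1..Suc d} \<and> Suc d \<in> u}"
  by (auto simp: subset_iff) (metis le_SucE)

lemma sum_subsets_Suc:
  "(\<Sum>u \<in> {u. u \<noteq> {} \<and> u \<subseteq> {1..Suc d}}. F u)
    = (\<Sum>u \<in> {u. u \<noteq> {} \<and> u \<subseteq> {1..d}}. F u) + (\<Sum>u \<in> {u. u \<subseteq> {1..Suc d} \<and> Suc d \<in> u}. F u :: real)"
  unfolding subsets_Suc_eq by (rule sum.union_disjoint) auto

text \<open>The minimum over \<open>G m\<close> is at most the mean, and \<open>sum_E_le\<close>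
  bounds the total over all \<open>2 ^ m\<close> candidates.\<close>

lemma B_step:
  assumes f: "irreducible f" "degree f = m"
    and pos: "\<And>u. u \<subseteq> {1..Suc d} \<Longrightarrow> \<gamma> u * (\<Prod>i\<in>u. b i - a i) \<ge> 0"
    and min: "is_arg_min (\<lambda>h. B m \<gamma> a b (Suc d) (g(Suc d := h)) f) (\<lambda>h. h \<in> G m) (g (Suc d))"
  shows "B m \<gamma> a b (Suc d) g f \<le> B m \<gamma> a b d g f
    + 1 / 2 ^ m * (\<Sum>u \<in> {u. u \<subseteq> {1..Suc d} \<and> Suc d \<in> u}.
        \<gamma> u * (real m / 2) ^ card u * (\<Prod>i\<in>u. b i - a i))"
proof -
  have f0: "f \<noteq> 0" using f(1) by auto
  let ?U = "{u. u \<subseteq> {1..Suc d} \<and> Suc d \<in> u}"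
  define T where "T h = (\<Sum>u\<in>?U. \<gamma> u * (\<Prod>i\<in>u. b i - a i)
    * E m (poly_lattice m (Suc d) (g(Suc d := h)) f) u)" for h
  have B_eq: "B m \<gamma> a b (Suc d) (g(Suc d := h)) f = B m \<gamma> a b d g f + T h" for h
  proof -
    have "E m (poly_lattice m (Suc d) (g(Suc d := h)) f) u = E m (poly_lattice m d g f) u"
      if "u \<subseteq> {1..d}" for u
      using that by (intro E_poly_lattice_eqI f0 f(2)) force+
    thus ?thesis unfolding B_def sum_subsets_Suc T_def by simp
  qed
  \<comment> \<open>The part \<open>B m \<gamma> a b d g f\<close> is constant in \<open>h\<close>,
    so a minimizer of \<open>B\<close> also minimizes \<open>T\<close>.\<close>
  have "T (g (Suc d)) \<le> T h" if "h \<in> G m" for h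
    using min that unfolding is_arg_min_linorder B_eq by simp
  hence "(\<Sum>h\<in>G m. T (g (Suc d))) \<le> (\<Sum>h\<in>G m. T h)" by (rule sum_mono)
  also have "\<dots> = (\<Sum>u\<in>?U. \<gamma> u * (\<Prod>i\<in>u. b i - a i)
      * (\<Sum>h\<in>G m. E m (poly_lattice m (Suc d) (g(Suc d := h)) f) u))"
    unfolding T_def sum_distrib_left by (rule sum.swap)
  also have "\<dots> \<le> (\<Sum>u\<in>?U. \<gamma> u * (\<Prod>i\<in>u. b i - a i) * (real m / 2) ^ card u)"
    using pos by (intro sum_mono mult_left_mono sum_E_le f) auto
  finally have "T (g (Suc d)) \<le> 1 / 2 ^ m * (\<Sum>u\<in>?U. \<gamma> u * (real m / 2) ^ card u * (\<Prod>i\<in>u. b i - a i))"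
    by (simp add: card_G field_simps)
  thus ?thesis using B_eq[of "g (Suc d)"] by simp
qed

theorem theorem5:
  fixes s m :: nat
    and a b :: "nat \<Rightarrow> real"
    and \<gamma> :: "nat set \<Rightarrow> real"
    and f :: "bit poly"
    and gs :: "nat \<Rightarrow> bit poly"
  assumes "s \<ge> 1" and "m \<ge> 1"
    and "\<forall>i\<in>{1..s}. a i < b i"
    and "\<forall>u. u \<subseteq> {1..s} \<longrightarrow> \<gamma> u > 0"
    and "irreducible f" and "degree f = m"
    and "\<forall>i\<in>{1..s}. gs i \<in> G m"
    and "gs 1 = 1"
    and "\<forall>d\<in>{2..s}. is_arg_min (\<lambda>h. B m \<gamma> a b d (gs(d := h)) f) (\<lambda>h. h \<in> G m) (gs d)"
  shows "\<forall>d\<in>{1..s}.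
           B m \<gamma> a b d gs f
             \<le> 1 / 2 ^ m * (\<Sum>u \<in> {u. u \<noteq> {} \<and> u \<subseteq> {1..d}}.
                               \<gamma> u * (real m / 2) ^ card u * (\<Prod>i\<in>u. b i - a i))"
proof -
  define S where "S d = (\<Sum>u \<in> {u. u \<noteq> {} \<and> u \<subseteq> {1..d}}.
    \<gamma> u * (real m / 2) ^ card u * (\<Prod>i\<in>u. b i - a i))" for d
  have pos: "\<gamma> u * (\<Prod>i\<in>u. b i - a i) \<ge> 0" if "u \<subseteq> {1..s}" for u
  proof (intro mult_nonneg_nonneg prod_nonneg)
    show "0 \<le> \<gamma> u" using assms(4) that by (simp add: less_imp_le)
    show "0 \<le> b i - a i" if "i \<in> u" for i
      using assms(3) \<open>u \<subseteq> {1..s}\<close> that by (simp add: less_imp_le subset_iff)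
  qed
  have "B m \<gamma> a b d gs f \<le> 1 / 2 ^ m * S d" if "1 \<le> d" "d \<le> s" for d
    using that
  proof (induction d rule: dec_induct)
    \<comment> \<open>In dimension 1 the left side is 0 and the bound is nonnegative.\<close>
    case base
    have "{u. u \<noteq> {} \<and> u \<subseteq> {1..1}} = {{1 :: nat}}" by auto
    moreover have "0 \<le> \<gamma> {1} * (b 1 - a 1) * (real m / 2)"
      using pos[of "{1}"] assms(1) by simp
    ultimately show ?case
      using E_poly_lattice_1[of f m gs] assms(2,5,6,8) by (simp add: B_def S_def mult_ac)
  next
    case (step d)
    have "is_arg_min (\<lambda>h. B m \<gamma> a b (Suc d) (gs(Suc d := h)) f) (\<lambda>h. h \<in> G m) (gs (Suc d))"
      using assms(9) step by simp
    moreover have "\<gamma> u * (\<Prod>i\<in>u. b i - a i) \<ge> 0" if "u \<subseteq> {1..Suc d}" for u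
      using pos[of u] that step.prems by (force simp: subset_iff)
    \<comment> \<open>The induction hypothesis covers the sets without \<open>Suc d\<close>, and the
      increment from \<open>B_step\<close> those containing it.\<close>
    ultimately show ?case
      using B_step[OF assms(5,6), where \<gamma> = \<gamma> and a = a and b = b and d = d and g = gs] step
      unfolding S_def sum_subsets_Suc distrib_left by fastforce
  qed
  thus ?thesis unfolding S_def by simp
qed

end
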